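(* Let $C\in M_n$ be a non-scalar Hermitian matrix, and let $\mathbf{A}=(A_1,\dots,A_m)\in M_n^m$. (a) $W_C(\mathbf{A})$ is a singleton if and only if for each $j=1,\dots,m$, $A_j=a_jI$ is a scalar matrix. (b) $W_C(\mathbf{A})$ is a line segment in $\mathbb{C}^m$ if and only if there is a Hermitian matrix $H\in M_n$ such that $A_j\in\operatorname{span}\{I,H\}$ for each $j=1,\dots,m$.
   Context: $M_n$ is the set of $n\times n$ complex matrices. For a Hermitian $C\in M_n$ and $\mathbf{A}=(A_1,\dots,A_m)\in M_n^m$, the joint $C$-numerical range is $$W_C(\mathbf{A})=\{(\operatorname{tr} CU^*A_1U,\dots,\operatorname{tr} CU^*A_mU): U\in M_n \text{ unitary}\}\subseteq\mathbb{C}^m .$$ A line segment in $\mathbb{C}^m$ means the convex hull of two points, which may coincide (so a degenerate segment, i.e. a single point, is allowed). The span is over $\mathbb{C}$. *)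

theory Defs
  imports "HOL-Analysis.Analysis"
begin

definition conj_transpose :: "complex^'n^'m \<Rightarrow> complex^'m^'n"
  where "conj_transpose A = map_matrix cnj (transpose A)"

definition hermitian :: "complex^'n^'n \<Rightarrow> bool"
  where "hermitian A \<longleftrightarrow> conj_transpose A = A"

definition unitary :: "complex^'n^'n \<Rightarrow> bool"
  where "unitary U \<longleftrightarrow> conj_transpose U ** U = mat 1 \<and> U ** conj_transpose U = mat 1"

text \<open>
  On matrices \<open>scaleR\<close> only provides real scalars, and \<open>*s\<close> takes scalars from the row type.
  The complex span is therefore obtained from an explicit complex scalar multiplication.
\<close>

definition mat_scale :: "complex \<Rightarrow> complex^'n^'m \<Rightarrow> complex^'n^'m"
  where "mat_scale c A = map_matrix (\<lambda>x. c * x) A"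

interpretation cmat: vector_space "mat_scale :: complex \<Rightarrow> complex^'n^'m \<Rightarrow> complex^'n^'m"
  by unfold_locales (simp_all add: mat_scale_def vec_eq_iff algebra_simps)

definition joint_C_numerical_range :: "complex^'n^'n \<Rightarrow> complex^'n^'n^'m \<Rightarrow> (complex^'m) set"
  where "joint_C_numerical_range C A =
    {(\<chi> j. trace (C ** conj_transpose U ** (A $ j) ** U)) | U. unitary U}"

text \<open>
  The hull is the real convex hull in \<open>complex^'m\<close>; the two end points may coincide.
\<close>

definition is_line_segment :: "(complex^'m) set \<Rightarrow> bool"
  where "is_line_segment S \<longleftrightarrow> (\<exists>p q. S = convex hull {p, q})"

end

theory Submission
  imports Defs
begin

text \<open>
  Write \<open>v\<^sup>*\<close> for the conjugate transpose. Since \<open>tr (C U\<^sup>* X U) = tr (U C U\<^sup>* X)\<close>, the numerical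
  range consists of the values of the functionals \<open>tr (\<cdot> A\<^sub>j)\<close> on the unitary orbit of \<open>C\<close>.

  The heart of the matter is that \<open>A\<close> is scalar as soon as \<open>tr (\<cdot> A)\<close> is constant on the orbit of a
  non-scalar Hermitian \<open>C\<close> (\<open>scalar_if_trace_form_constant\<close>). In place of a derivative along a
  one-parameter group, the proof uses the unitaries \<open>I + s v v\<^sup>*\<close>, where \<open>s\<close> runs over a circle
  through \<open>0\<close>. Comparing finitely many values of \<open>s\<close> isolates the terms linear in \<open>s\<close>
  (\<open>invariant_functional_rank_one\<close>). For the functional \<open>tr (\<cdot> A)\<close> this yields
  \<open>v\<^sup>* (C A - A C) v = 0\<close> for all \<open>v\<close>, so \<open>A\<close> commutes with \<open>C\<close>, and by the same argument
  with every matrix in the orbit of \<open>C\<close>. The entries of \<open>X A - A X\<close> are then again functionals of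
  \<open>X\<close> that are constant on the orbit; for these the linear terms say that \<open>A\<close> commutes with a
  rank-one matrix \<open>v y\<^sup>*\<close>, where \<open>y \<noteq> 0\<close> unless \<open>v\<close> is an eigenvector of \<open>C\<close>. Hence each vector is
  an eigenvector of \<open>A\<close> or of \<open>C\<close>. As \<open>C\<close> may be replaced by any element of its orbit, and
  unitaries move any vector to any other of the same length, one vector that is not an
  eigenvector of \<open>C\<close> suffices to make every vector an eigenvector of \<open>A\<close>.

  Part (b) reduces to this. If the range is the segment \<open>p + [0,1] d\<close> and \<open>d\<^sub>k \<noteq> 0\<close>, put
  \<open>G = A\<^sub>k / d\<^sub>k\<close>. Then \<open>A\<^sub>j - d\<^sub>j G\<close> and \<open>G - G\<^sup>*\<close> give constant functionals, hence are scalar,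
  and the Hermitian part of \<open>G\<close> serves as \<open>H\<close>. Conversely, for \<open>A\<^sub>j = a\<^sub>j I + b\<^sub>j H\<close> the range is the
  image of the real set \<open>W\<^sub>C(H)\<close> under an affine map, and \<open>W\<^sub>C(H)\<close> is a compact interval because the
  unitary group is compact and connected. Connectedness comes from the same matrices
  \<open>I + s v v\<^sup>*\<close>: they carry a unitary to the identity in finitely many steps, each step fixing at least
  one more basis vector (\<open>connected_component_unitary_mat_1\<close>).
\<close>

section \<open>The Hermitian inner product and rank-one matrices\<close>

definition cdot :: "complex^'n \<Rightarrow> complex^'n \<Rightarrow> complex"
  where "cdot x y = (\<Sum>i\<in>UNIV. cnj (x $ i) * y $ i)"

definition outer :: "complex^'n \<Rightarrow> complex^'m \<Rightarrow> complex^'m^'n"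
  where "outer x y = (\<chi> i j. x $ i * cnj (y $ j))"

lemma cdot_add_left: "cdot (x + y) z = cdot x z + cdot y z"
  by (simp add: cdot_def algebra_simps sum.distrib)

lemma cdot_add_right: "cdot x (y + z) = cdot x y + cdot x z"
  by (simp add: cdot_def algebra_simps sum.distrib)

lemma cdot_diff_left: "cdot (x - y) z = cdot x z - cdot y z"
  by (simp add: cdot_def algebra_simps sum_subtractf)

lemma cdot_diff_right: "cdot x (y - z) = cdot x y - cdot x z"
  by (simp add: cdot_def algebra_simps sum_subtractf)

lemma cdot_scale_left: "cdot (c *s x) y = cnj c * cdot x y"
  by (simp add: cdot_def algebra_simps sum_distrib_left)

lemma cdot_scale_right: "cdot x (c *s y) = c * cdot x y"
  by (simp add: cdot_def algebra_simps sum_distrib_left)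

lemma cnj_cdot: "cnj (cdot x y) = cdot y x"
  by (simp add: cdot_def algebra_simps)

lemma cdot_self: "cdot x x = of_real ((norm x)\<^sup>2)"
proof -
  have "(norm x)\<^sup>2 = (\<Sum>i\<in>UNIV. (cmod (x $ i))\<^sup>2)"
    by (simp add: norm_vec_def L2_set_def sum_nonneg)
  then show ?thesis
    by (simp add: cdot_def complex_norm_square mult.commute del: of_real_power)
qed

lemma cdot_self_eq_0: "cdot x x = 0 \<longleftrightarrow> x = 0"
  by (simp add: cdot_self)

lemma cdot_axis_left: "cdot (axis i 1) x = x $ i"
proof -
  have "cdot (axis i 1) x = (\<Sum>k\<in>UNIV. if k = i then x $ k else 0)"
    unfolding cdot_def by (rule sum.cong) (auto simp: axis_def)
  then show ?thesis by simp
qed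

lemma conj_transpose_nth: "conj_transpose M $ i $ j = cnj (M $ j $ i)"
  by (simp add: conj_transpose_def transpose_def)

lemma conj_transpose_mul: "conj_transpose (M ** N) = conj_transpose N ** conj_transpose M"
  by (simp add: vec_eq_iff conj_transpose_nth matrix_matrix_mult_def mult.commute)

lemma conj_transpose_conj_transpose [simp]: "conj_transpose (conj_transpose M) = M"
  by (simp add: vec_eq_iff conj_transpose_nth)

lemma conj_transpose_mat_1 [simp]: "conj_transpose (mat 1) = mat 1"
  by (auto simp: vec_eq_iff conj_transpose_nth mat_def)

lemma trace_conj_transpose: "trace (conj_transpose M) = cnj (trace M)"
  by (simp add: trace_def conj_transpose_nth)

lemma cdot_matrix_left: "cdot (M *v x) y = cdot x (conj_transpose M *v y)"
proof -
  have "cdot (M *v x) y = (\<Sum>i\<in>UNIV. \<Sum>j\<in>UNIV. cnj (M $ i $ j) * cnj (x $ j) * y $ i)"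
    by (simp add: cdot_def matrix_vector_mult_def sum_distrib_right)
  also have "\<dots> = (\<Sum>j\<in>UNIV. \<Sum>i\<in>UNIV. cnj (M $ i $ j) * cnj (x $ j) * y $ i)"
    by (rule sum.swap)
  also have "\<dots> = cdot x (conj_transpose M *v y)"
    by (simp add: cdot_def matrix_vector_mult_def sum_distrib_left conj_transpose_nth algebra_simps)
  finally show ?thesis .
qed

lemma cdot_unitary: "unitary U \<Longrightarrow> cdot (U *v x) (U *v y) = cdot x y"
  by (simp add: cdot_matrix_left matrix_vector_mul_assoc unitary_def)

lemma matrix_vector_axis: "(M *v axis j 1) $ i = (M $ i $ j :: complex)"
  by (simp add: matrix_vector_mult_def axis_def if_distrib[of "\<lambda>x. _ * x"] cong: if_cong)

lemma mat_scale_nth: "mat_scale c M $ i $ j = c * M $ i $ j"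
  by (simp add: mat_scale_def)

lemma mat_scale_mat: "mat_scale c (mat d) = mat (c * d)"
  by (simp add: vec_eq_iff mat_scale_nth mat_def)

lemma matrix_mul_add_left: "(M + N) ** P = M ** P + N ** P"
  by (simp add: vec_eq_iff matrix_matrix_mult_def algebra_simps sum.distrib)

lemma matrix_mul_scale_left: "mat_scale c M ** N = mat_scale c (M ** N)"
  by (simp add: vec_eq_iff matrix_matrix_mult_def mat_scale_nth sum_distrib_left algebra_simps)

lemma matrix_mul_scale_right: "M ** mat_scale c N = mat_scale c (M ** N)"
  by (simp add: vec_eq_iff matrix_matrix_mult_def mat_scale_nth sum_distrib_left algebra_simps)

lemma trace_scale: "trace (mat_scale c M) = c * trace M"
  by (simp add: trace_def mat_scale_nth sum_distrib_left)

lemma matrix_mul_outer: "M ** outer x y = outer (M *v x) y"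
  by (simp add: vec_eq_iff matrix_matrix_mult_def matrix_vector_mult_def outer_def
      sum_distrib_right mult.assoc)

lemma outer_mul_matrix: "outer x y ** M = outer x (conj_transpose M *v y)"
  by (simp add: vec_eq_iff matrix_matrix_mult_def matrix_vector_mult_def outer_def
      conj_transpose_nth sum_distrib_left algebra_simps)

lemma outer_mul_vector: "outer x y *v z = cdot y z *s x"
  by (simp add: vec_eq_iff matrix_vector_mult_def outer_def cdot_def
      sum_distrib_left algebra_simps)

lemma trace_outer: "trace (outer x y) = cdot y x"
  by (simp add: trace_def outer_def cdot_def mult.commute)

lemma mat_scale_vector: "mat_scale c M *v x = c *s (M *v x)"
  by (simp add: vec_eq_iff matrix_vector_mult_def mat_scale_nth sum_distrib_left algebra_simps)

lemma outer_add_left: "outer (x + y) z = outer x z + outer y z"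
  by (simp add: vec_eq_iff outer_def algebra_simps)

lemma outer_scale_left: "outer (c *s x) y = mat_scale c (outer x y)"
  by (simp add: vec_eq_iff outer_def mat_scale_nth)

lemma outer_diff_right: "outer x (y - z) = outer x y - outer x z"
  by (simp add: vec_eq_iff outer_def algebra_simps)

lemma outer_scale_right: "outer x (c *s y) = mat_scale (cnj c) (outer x y)"
  by (simp add: vec_eq_iff outer_def mat_scale_nth)

section \<open>Unitary rank-one perturbations of the identity\<close>

text \<open>
  When \<open>v \<noteq> 0\<close>, this matrix multiplies \<open>v\<close> by \<open>1 + s \<parallel>v\<parallel>\<^sup>2\<close> and fixes the orthogonal complement of
  \<open>v\<close>. The vector is not normalised, so that no square roots occur; unitarity is the condition
  \<open>s + cnj s + s * cnj s * cdot v v = 0\<close>, which describes a circle through \<open>0\<close>.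
\<close>

definition reflection :: "complex \<Rightarrow> complex^'n \<Rightarrow> complex^'n^'n"
  where "reflection s v = mat 1 + mat_scale s (outer v v)"

lemma reflection_0 [simp]: "reflection 0 v = mat 1"
  by (simp add: reflection_def)

lemma conj_transpose_reflection: "conj_transpose (reflection s v) = reflection (cnj s) v"
  by (auto simp: vec_eq_iff conj_transpose_nth reflection_def mat_scale_nth outer_def mat_def mult.commute)

lemma reflection_mul_reflection: "reflection s v ** reflection t v = reflection (s + t + s * t * cdot v v) v"
  by (simp add: reflection_def matrix_mul_add_left matrix_add_ldistrib matrix_mul_scale_left
      matrix_mul_scale_right matrix_mul_outer outer_mul_vector outer_scale_left
      outer_add_left matrix_vector_mult_add_rdistrib mat_scale_vector cmat.scale_right_distrib
      cmat.scale_left_distrib algebra_simps)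

lemma reflection_mul_vector: "reflection s v *v x = x + (s * cdot v x) *s v"
  by (simp add: reflection_def matrix_vector_mult_add_rdistrib outer_mul_vector mat_scale_vector
      vector_smult_assoc)

lemma unitary_reflection:
  assumes "s + cnj s + s * cnj s * cdot v v = 0"
  shows "unitary (reflection s v)"
  using assms
  by (simp add: unitary_def conj_transpose_reflection reflection_mul_reflection add.commute mult.commute)

lemma unitary_mul:
  assumes "unitary U" "unitary V"
  shows "unitary (U ** V)"
proof -
  have "conj_transpose (U ** V) ** (U ** V)
      = conj_transpose V ** ((conj_transpose U ** U) ** V)"
    by (simp add: conj_transpose_mul matrix_mul_assoc)
  moreover have "(U ** V) ** conj_transpose (U ** V)
      = U ** ((V ** conj_transpose V) ** conj_transpose U)"
    by (simp add: conj_transpose_mul matrix_mul_assoc)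
  ultimately show ?thesis
    using assms by (simp add: unitary_def)
qed

lemma unitary_mat_1: "unitary (mat 1)"
  using unitary_reflection[of 0 0] by simp

text \<open>
  The complex form of the Householder construction. For \<open>v \<noteq> w\<close>, moving \<open>w\<close> to \<open>v\<close> along \<open>v - w\<close> forces
  \<open>s * cdot (v - w) w = 1\<close>, and this \<open>s\<close> is admissible exactly because \<open>v\<close> and \<open>w\<close> have the same length.
\<close>

lemma householder:
  assumes "cdot v v = cdot w w"
  obtains s where "s + cnj s + s * cnj s * cdot (v - w) (v - w) = 0" "reflection s (v - w) *v w = v"
proof (cases "v = w")
  case True
  then show ?thesis using that[of 0] by simp
next
  case False
  define a where "a = cdot (v - w) w"
  have q: "cdot (v - w) (v - w) = - a - cnj a"
    using assms by (simp add: a_def cdot_diff_left cdot_diff_right cnj_cdot)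
  have "a \<noteq> 0"
    using q False cdot_self_eq_0[of "v - w"] by auto
  show ?thesis
  proof
    show "1/a + cnj (1/a) + 1/a * cnj (1/a) * cdot (v - w) (v - w) = 0"
      unfolding q using \<open>a \<noteq> 0\<close> by (simp add: field_simps)
    show "reflection (1/a) (v - w) *v w = v"
      using \<open>a \<noteq> 0\<close> by (simp add: reflection_mul_vector a_def[symmetric])
  qed
qed

section \<open>Two criteria for matrices\<close>

text \<open>
  Polarisation over the complex numbers. Both \<open>e\<^sub>i + e\<^sub>j\<close> and \<open>e\<^sub>i + \<i> e\<^sub>j\<close> are used, since a real
  combination alone only yields that the matrix is antisymmetric.
\<close>

lemma matrix_eq_0_if_form_0:
  fixes M :: "complex^'n^'n"
  assumes "\<And>v. cdot v (M *v v) = 0"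
  shows "M = 0"
proof -
  define e :: "'n \<Rightarrow> complex^'n" where "e i = axis i 1" for i
  have entry: "cdot (e i) (M *v e j) = M $ i $ j" for i j
    by (simp add: e_def cdot_axis_left matrix_vector_axis)
  have expand: "M $ i $ j * c + M $ j $ i * cnj c = 0" for i j c
    using assms[of "e i + c *s e j"] assms[of "e i"] assms[of "e j"]
    by (simp add: matrix_vector_right_distrib matrix_vector_mult_scaleR vector_scalar_commute
        cdot_add_left cdot_add_right cdot_scale_left cdot_scale_right entry algebra_simps)
  have "M $ i $ j = 0" for i j
    using expand[of i j 1] expand[of i j \<i>] by (simp add: algebra_simps)
  then show ?thesis by (simp add: vec_eq_iff)
qed

lemma mat_if_all_eigenvectors:
  fixes M :: "complex^'n^'n"
  assumes "\<And>v. \<exists>a. M *v v = a *s v"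
  shows "\<exists>a. M = mat a"
proof -
  have off: "M $ i $ j = 0" if "i \<noteq> j" for i j
  proof -
    obtain a where "M *v axis j 1 = a *s axis j 1" using assms by blast
    then have "(M *v axis j 1) $ i = (a *s axis j 1) $ i" by simp
    then show ?thesis using that by (simp add: matrix_vector_axis) (simp add: axis_def)
  qed
  have diag: "M $ i $ i = M $ j $ j" for i j
  proof (cases "i = j")
    case False
    obtain a where "M *v (axis i 1 + axis j 1) = a *s (axis i 1 + axis j 1)"
      using assms by blast
    then have "(M *v (axis i 1 + axis j 1)) $ k = (a *s (axis i 1 + axis j 1)) $ k" for k
      by simp
    from this[of i] this[of j] show ?thesis using False off[of i j] off[of j i]
      by (simp add: matrix_vector_right_distrib matrix_vector_axis) (simp add: axis_def)
  qed simp
  have "M = mat (M $ undefined $ undefined)"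
    using off diag by (simp add: vec_eq_iff mat_def)
  then show ?thesis by blast
qed

section \<open>Functionals that are constant on the unitary orbit\<close>

text \<open>
  Expanding \<open>L ((I + s P) C (I + cnj s P)) = L C\<close> with \<open>P = v v\<^sup>*\<close> gives
  \<open>s x + cnj s y + s (cnj s) z = 0\<close> for \<open>x = L (P C)\<close>, \<open>y = L (C P)\<close>, \<open>z = L (P C P)\<close>. On the circle,
  \<open>s (cnj s)\<close> is a multiple of \<open>s + cnj s\<close>, so this is a real-linear equation in \<open>s\<close>, and two values
  of \<open>s\<close> that are linearly independent over the reals determine \<open>x\<close> and \<open>y\<close> in terms of \<open>z\<close>.
\<close>

lemma invariant_functional_rank_one:
  fixes C :: "complex^'n^'n" and L :: "complex^'n^'n \<Rightarrow> complex"
  assumes add: "\<And>X Y. L (X + Y) = L X + L Y"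
    and scale: "\<And>c X. L (mat_scale c X) = c * L X"
    and inv: "\<And>U. unitary U \<Longrightarrow> L (U ** C ** conj_transpose U) = L C"
  defines "P \<equiv> (\<lambda>v. outer v v)"
  shows "cdot v v * L (P v ** C) = L (P v ** C ** P v)"
    and "cdot v v * L (C ** P v) = L (P v ** C ** P v)"
proof -
  define q x y z where "q = cdot v v" and "x = L (P v ** C)" and "y = L (C ** P v)"
    and "z = L (P v ** C ** P v)"
  have "q * x = z \<and> q * y = z"
  proof (cases "v = 0")
    case True
    then have "P v = 0" "q = 0" by (simp_all add: P_def outer_def q_def cdot_def vec_eq_iff)
    moreover have "L 0 = 0" using add[of 0 0] by simp
    ultimately show ?thesis by (simp add: z_def matrix_matrix_mult_def zero_vec_def)
  next
    case False
    then have q: "q \<noteq> 0" "cnj q = q" by (simp_all add: q_def cdot_self_eq_0 cnj_cdot)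
    have eq: "s * x + cnj s * y + s * cnj s * z = 0" if s: "s + cnj s + s * cnj s * q = 0" for s
    proof -
      have "reflection s v ** C ** conj_transpose (reflection s v)
          = C + mat_scale s (P v ** C) + mat_scale (cnj s) (C ** P v)
              + mat_scale (s * cnj s) (P v ** C ** P v)"
        unfolding conj_transpose_reflection unfolding reflection_def P_def
        by (simp add: matrix_mul_add_left matrix_add_ldistrib
            matrix_mul_scale_left matrix_mul_scale_right cmat.scale_right_distrib mult.commute)
      then show ?thesis
        using inv[OF unitary_reflection, of s v] s
        by (simp add: add scale q_def x_def y_def z_def add.assoc)
    qed
    (* The two values of s belong to the factors 1 + s q = -1 and 1 + s q = \<i> on v. *)
    have "- 2 / q * x + - 2 / q * y + 4 / (q * q) * z = 0"
      using eq[of "- 2 / q"] q by (simp add: field_simps)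
    then have 1: "q * x + q * y = 2 * z"
      using q by (simp add: field_simps; algebra)
    have "(\<i> - 1) / q * x + (- \<i> - 1) / q * y + 2 / (q * q) * z = 0"
      using eq[of "(\<i> - 1) / q"] q by (simp add: field_simps)
    then have 2: "(\<i> - 1) * (q * x) + (- \<i> - 1) * (q * y) + 2 * z = 0"
      using q by (simp add: field_simps; algebra)
    from 1 2 have "\<i> * (q * x - q * y) = 0" by algebra
    then have "q * x = q * y" by simp
    with 1 show ?thesis by simp
  qed
  then show "cdot v v * L (P v ** C) = L (P v ** C ** P v)"
    and "cdot v v * L (C ** P v) = L (P v ** C ** P v)"
    by (simp_all add: q_def x_def y_def z_def)
qed


text \<open>
  The two linear terms of the previous lemma agree, that is, \<open>tr (P C A) = tr (C P A)\<close> for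
  \<open>P = v v\<^sup>*\<close>. These traces are the values of the forms of \<open>C A\<close> and \<open>A C\<close> at \<open>v\<close>, and a form
  determines its matrix.
\<close>

lemma commute_if_trace_invariant:
  fixes A C :: "complex^'n^'n"
  assumes "\<And>U. unitary U \<Longrightarrow> trace (U ** C ** conj_transpose U ** A) = trace (C ** A)"
  shows "C ** A = A ** C"
proof -
  have "cdot v ((C ** A - A ** C) *v v) = 0" for v
  proof (cases "v = 0")
    case False
    let ?L = "\<lambda>X. trace (X ** A)" and ?P = "outer v v"
    have add: "?L (X + Y) = ?L X + ?L Y" for X Y
      by (simp add: matrix_mul_add_left trace_add)
    have scale: "?L (mat_scale c X) = c * ?L X" for c X
      by (simp add: matrix_mul_scale_left trace_scale)
    have "cdot v v * ?L (?P ** C) = cdot v v * ?L (C ** ?P)"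
      using invariant_functional_rank_one[of ?L C v, OF add scale assms] by simp
    then have "?L (?P ** C) = ?L (C ** ?P)"
      using False by (simp add: cdot_self_eq_0)
    moreover have "?L (?P ** C) = cdot v (C ** A *v v)"
      by (simp add: outer_mul_matrix trace_outer cdot_matrix_left matrix_vector_mul_assoc
          conj_transpose_mul)
    moreover have "?L (C ** ?P) = cdot v (A ** C *v v)"
      by (simp add: outer_mul_matrix matrix_mul_outer trace_outer cdot_matrix_left
          matrix_vector_mul_assoc)
    ultimately show ?thesis
      by (simp add: matrix_vector_mult_diff_rdistrib cdot_diff_right)
  qed (simp add: cdot_def)
  then have "C ** A - A ** C = 0"
    by (rule matrix_eq_0_if_form_0)
  then show ?thesis by simp
qed

text \<open>
  All entries of \<open>X \<mapsto> X A - A X\<close> vanish on the orbit of \<open>C\<close>. Consequently \<open>A\<close> commutes with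
  \<open>\<parallel>v\<parallel>\<^sup>2 P C - P C P\<close> for \<open>P = v v\<^sup>*\<close>, which for Hermitian \<open>C\<close> is the rank-one matrix \<open>v y\<^sup>*\<close> with
  \<open>y = \<parallel>v\<parallel>\<^sup>2 C v - (v\<^sup>* C v) v\<close>. A matrix commuting with \<open>v y\<^sup>* \<noteq> 0\<close> maps the line of \<open>v\<close> to itself,
  while \<open>y = 0\<close> says that \<open>v\<close> is an eigenvector of \<open>C\<close>.
\<close>

lemma eigenvector_dichotomy:
  fixes A C :: "complex^'n^'n"
  assumes herm: "hermitian C"
    and comm: "\<And>U. unitary U \<Longrightarrow>
      (U ** C ** conj_transpose U) ** A = A ** (U ** C ** conj_transpose U)"
  shows "(\<exists>a. A *v v = a *s v) \<or> (\<exists>a. C *v v = a *s v)"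
proof (cases "v = 0")
  case True
  then show ?thesis by simp
next
  case False
  define q \<kappa> where "q = cdot v v" and "\<kappa> = cdot v (C *v v)"
  define y where "y = q *s (C *v v) - \<kappa> *s v"
  have C: "conj_transpose C = C" using herm by (simp add: hermitian_def)
  have q: "q \<noteq> 0" "cnj q = q" using False by (simp_all add: q_def cdot_self_eq_0 cnj_cdot)
  have \<kappa>: "cnj \<kappa> = \<kappa>" by (simp add: \<kappa>_def cnj_cdot cdot_matrix_left C)
  have y: "outer v y = mat_scale q (outer v v ** C) - outer v v ** C ** outer v v"
    by (simp add: y_def outer_diff_right outer_scale_right q \<kappa> outer_mul_matrix C
        matrix_mul_outer outer_mul_vector outer_scale_left cdot_matrix_left flip: \<kappa>_def)
  have "outer v y ** A = A ** outer v y"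
  proof -
    have "(outer v y ** A - A ** outer v y) $ i $ j = 0" for i j
    proof -
      let ?L = "\<lambda>X. (X ** A - A ** X) $ i $ j"
      have add: "?L (X + Y) = ?L X + ?L Y" for X Y
        by (simp add: matrix_mul_add_left matrix_add_ldistrib)
      have scale: "?L (mat_scale c X) = c * ?L X" for c X
        by (simp add: matrix_mul_scale_left matrix_mul_scale_right mat_scale_nth algebra_simps)
      have inv: "?L (U ** C ** conj_transpose U) = ?L C" if "unitary U" for U
        using comm[OF that] comm[OF unitary_mat_1] by simp
      have "?L (outer v y) + ?L (outer v v ** C ** outer v v) = q * ?L (outer v v ** C)"
        unfolding scale[symmetric] add[symmetric] y by simp
      then show ?thesis
        using invariant_functional_rank_one(1)[of ?L C v, OF add scale inv] by (simp add: q_def)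
    qed
    then have "outer v y ** A - A ** outer v y = 0" by (simp only: vec_eq_iff zero_index simp_thms)
    then show ?thesis by simp
  qed
  then have "outer v y *v (A *v y) = A *v (outer v y *v y)"
    by (simp add: matrix_vector_mul_assoc)
  then have Av: "cdot y (A *v y) *s v = cdot y y *s (A *v v)"
    by (simp add: outer_mul_vector vector_scalar_commute)
  show ?thesis
  proof (cases "y = 0")
    case True
    then have "C *v v = (\<kappa> / q) *s v"
      using q by (simp add: y_def vec_eq_iff field_simps)
    then show ?thesis by blast
  next
    case False
    then have "cdot y y \<noteq> 0" by (simp add: cdot_self_eq_0)
    then have "A *v v = (cdot y (A *v y) / cdot y y) *s v"
      using Av by (simp add: vec_eq_iff field_simps)
    then show ?thesis by blast
  qed
qed

lemma hermitian_conjugate: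
  "hermitian C \<Longrightarrow> hermitian (U ** C ** conj_transpose U)"
  by (simp add: hermitian_def conj_transpose_mul matrix_mul_assoc)

text \<open>
  The dichotomy is applied to conjugates of \<open>C\<close>: if \<open>w\<close> is not an eigenvector of \<open>C\<close> and \<open>U w\<close> is a
  multiple of \<open>v\<close>, then \<open>v\<close> is not an eigenvector of \<open>U C U\<^sup>*\<close>, so it must be one of \<open>A\<close>.
\<close>

lemma scalar_if_commutes_with_orbit:
  fixes A C :: "complex^'n^'n"
  assumes herm: "hermitian C" and nonscalar: "\<not> (\<exists>c. C = mat c)"
    and comm: "\<And>U. unitary U \<Longrightarrow>
      (U ** C ** conj_transpose U) ** A = A ** (U ** C ** conj_transpose U)"
  shows "\<exists>a. A = mat a"
proof (rule mat_if_all_eigenvectors)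
  fix v
  obtain w where w: "\<And>a. C *v w \<noteq> a *s w"
    using mat_if_all_eigenvectors[of C] nonscalar by blast
  show "\<exists>a. A *v v = a *s v"
  proof (cases "v = 0")
    case False
    define t :: complex where "t = of_real (norm w / norm v)"
    have "w \<noteq> 0" using w[of 0] by auto
    then have "t \<noteq> 0" using False by (simp add: t_def)
    have "cdot (t *s v) (t *s v) = cdot w w"
      using False
      by (simp add: cdot_scale_left cdot_scale_right) (simp add: cdot_self t_def power2_eq_square)
    then obtain s where
      s: "s + cnj s + s * cnj s * cdot (t *s v - w) (t *s v - w) = 0"
      and sw: "reflection s (t *s v - w) *v w = t *s v"
      by (rule householder)
    define U where "U = reflection s (t *s v - w)"
    have U: "unitary U" using unitary_reflection[OF s] by (simp add: U_def)
    have Uw: "U *v w = t *s v" using sw by (simp add: U_def)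
    have U': "conj_transpose U *v (U *v x) = x" for x
      using U by (simp add: unitary_def matrix_vector_mul_assoc)
    let ?D = "U ** C ** conj_transpose U"
    have "?D *v (t *s v) \<noteq> a *s (t *s v)" for a
    proof
      assume eq: "?D *v (t *s v) = a *s (t *s v)"
      have "C *v w = conj_transpose U *v (?D *v (U *v w))"
        by (simp add: U' flip: matrix_vector_mul_assoc)
      also have "\<dots> = a *s w"
        using eq by (simp add: Uw[symmetric] vector_scalar_commute[symmetric] U')
      finally show False using w by simp
    qed
    moreover have "(V ** ?D ** conj_transpose V) ** A = A ** (V ** ?D ** conj_transpose V)"
      if "unitary V" for V
      using comm[OF unitary_mul[OF that U]] by (simp add: conj_transpose_mul matrix_mul_assoc)
    ultimately obtain a where "A *v (t *s v) = a *s (t *s v)"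
      using eigenvector_dichotomy[OF hermitian_conjugate[OF herm], of U A "t *s v"] by blast
    then have "t *s (A *v v) = t *s (a *s v)"
      by (simp add: vector_scalar_commute vector_smult_assoc mult.commute)
    then have "A *v v = a *s v" using \<open>t \<noteq> 0\<close> vector_mul_lcancel by blast
    then show ?thesis by blast
  qed simp
qed

section \<open>Constant trace functionals\<close>

definition trace_form :: "complex^'n^'n \<Rightarrow> complex^'n^'n \<Rightarrow> complex^'n^'n \<Rightarrow> complex"
  where "trace_form C X U = trace (C ** conj_transpose U ** X ** U)"

lemma trace_form_rotate: "trace_form C X U = trace (U ** C ** conj_transpose U ** X)"
  unfolding trace_form_def by (subst trace_mul_sym) (simp add: matrix_mul_assoc)

lemma trace_form_add: "trace_form C (X + Y) U = trace_form C X U + trace_form C Y U"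
  by (simp add: trace_form_rotate matrix_add_ldistrib trace_add)

lemma trace_form_diff: "trace_form C (X - Y) U = trace_form C X U - trace_form C Y U"
  using trace_form_add[of C "X - Y" Y U] by simp

lemma trace_form_scale: "trace_form C (mat_scale c X) U = c * trace_form C X U"
  by (simp add: trace_form_rotate matrix_mul_scale_right trace_scale)

lemma trace_form_mat:
  assumes "unitary U"
  shows "trace_form C (mat c) U = c * trace C"
proof -
  have "trace_form C (mat 1) U = trace C"
    using assms by (simp add: trace_form_def unitary_def flip: matrix_mul_assoc)
  then show ?thesis
    using trace_form_scale[of C c "mat 1" U] by (simp add: mat_scale_mat)
qed

lemma trace_form_conj_transpose:
  assumes "hermitian C"
  shows "trace_form C (conj_transpose X) U = cnj (trace_form C X U)"
proof -
  have "cnj (trace_form C X U) = trace (conj_transpose (C ** (conj_transpose U ** X ** U)))"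
    by (simp add: trace_form_def trace_conj_transpose matrix_mul_assoc)
  also have "\<dots> = trace (conj_transpose U ** conj_transpose X ** U ** C)"
    using assms by (simp add: conj_transpose_mul hermitian_def matrix_mul_assoc)
  also have "\<dots> = trace_form C (conj_transpose X) U"
    unfolding trace_form_def by (subst trace_mul_sym) (simp add: matrix_mul_assoc)
  finally show ?thesis by simp
qed

text \<open>
  Constancy passes from \<open>C\<close> to each \<open>U C U\<^sup>*\<close>, which has the same orbit. Thus \<open>A\<close> commutes with
  the whole orbit and not only with \<open>C\<close> itself.
\<close>

lemma scalar_if_trace_form_constant:
  fixes A C :: "complex^'n^'n"
  assumes herm: "hermitian C" and nonscalar: "\<not> (\<exists>c. C = mat c)"
    and const: "\<And>U. unitary U \<Longrightarrow> trace_form C A U = k"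
  shows "\<exists>a. A = mat a"
proof (rule scalar_if_commutes_with_orbit[OF herm nonscalar])
  fix U :: "complex^'n^'n"
  assume U: "unitary U"
  let ?D = "U ** C ** conj_transpose U"
  show "?D ** A = A ** ?D"
  proof (rule commute_if_trace_invariant)
    fix V :: "complex^'n^'n"
    assume "unitary V"
    then have "unitary (V ** U)" using U by (rule unitary_mul)
    then have "trace_form C A (V ** U) = trace_form C A U" using const U by simp
    then show "trace (V ** ?D ** conj_transpose V ** A) = trace (?D ** A)"
      by (simp add: trace_form_rotate conj_transpose_mul matrix_mul_assoc)
  qed
qed

section \<open>The unitary group is compact and connected\<close>

lemma continuous_on_matrix_mul:
  fixes f :: "'a::topological_space \<Rightarrow> complex^'n^'m" and g :: "'a \<Rightarrow> complex^'k^'n"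
  assumes "continuous_on S f" "continuous_on S g"
  shows "continuous_on S (\<lambda>x. f x ** g x)"
  unfolding matrix_matrix_mult_def using assms by (intro continuous_intros)

lemma continuous_on_conj_transpose:
  fixes f :: "'a::topological_space \<Rightarrow> complex^'n^'m"
  assumes "continuous_on S f"
  shows "continuous_on S (\<lambda>x. conj_transpose (f x))"
proof -
  have "conj_transpose (f x) = (\<chi> i j. cnj (f x $ j $ i))" for x
    by (simp add: vec_eq_iff conj_transpose_nth)
  then show ?thesis using assms by (simp, intro continuous_intros)
qed

lemma compact_unitary: "compact {U :: complex^'n^'n. unitary U}"
proof (rule compact_eq_bounded_closed[THEN iffD2], rule conjI)
  show "bounded {U :: complex^'n^'n. unitary U}"
    unfolding bounded_iff
  proof (intro exI ballI)
    fix U :: "complex^'n^'n"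
    assume "U \<in> {U. unitary U}"
    then have "(U ** conj_transpose U) $ i $ i = 1" for i
      by (simp add: unitary_def mat_def)
    then have "cdot (U $ i) (U $ i) = 1" for i
      by (simp add: matrix_matrix_mult_def conj_transpose_nth cdot_def mult.commute)
    then have "norm (U $ i) = 1" for i
      by (metis cdot_self norm_ge_zero of_real_eq_1_iff power2_eq_1_iff
          neg_0_le_iff_le not_one_le_zero)
    moreover have "norm U \<le> (\<Sum>i\<in>UNIV. norm (U $ i))"
      by (simp add: norm_vec_def L2_set_le_sum)
    ultimately show "norm U \<le> real CARD('n)" by simp
  qed
  show "closed {U :: complex^'n^'n. unitary U}"
    unfolding unitary_def
    by (intro closed_Collect_conj closed_Collect_eq continuous_on_matrix_mul
        continuous_on_conj_transpose continuous_on_id continuous_on_const)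
qed

text \<open>
  The admissible parameters \<open>s\<close> form a circle, which is connected and contains \<open>0\<close>, the parameter
  of the identity.
\<close>

lemma reflection_connected:
  fixes U :: "complex^'n^'n"
  assumes U: "unitary U" and s: "s + cnj s + s * cnj s * cdot v v = 0"
  shows "connected_component {U. unitary U} (reflection s v ** U) U"
proof (cases "v = 0")
  case True
  then have "reflection s v = mat 1"
    by (simp add: reflection_def outer_def vec_eq_iff mat_scale_nth)
  then show ?thesis using U by (simp add: connected_component_refl)
next
  case False
  define r where "r = 1 / (norm v)\<^sup>2"
  have r: "r > 0" "cdot v v = of_real (1 / r)" using False by (simp_all add: r_def cdot_self)
  define S where "S = {s. s + cnj s + s * cnj s * cdot v v = 0}"
  have "S = sphere (- of_real r) r"
  proof -
    have "s \<in> S \<longleftrightarrow> (2 * Re s + (norm s)\<^sup>2 / r = 0)" for s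
    proof -
      have "s + cnj s + s * cnj s * cdot v v = of_real (2 * Re s + (norm s)\<^sup>2 / r)"
        by (simp add: r complex_add_cnj flip: complex_norm_square)
      then show ?thesis by (simp only: S_def mem_Collect_eq of_real_eq_0_iff)
    qed
    also have "2 * Re s + (norm s)\<^sup>2 / r = 0 \<longleftrightarrow> (norm (s + of_real r))\<^sup>2 = r\<^sup>2" for s
    proof -
      have "(norm (s + of_real r))\<^sup>2 = (norm s)\<^sup>2 + 2 * r * Re s + r\<^sup>2"
        by (simp add: cmod_power2) (simp add: power2_eq_square algebra_simps)
      also have "\<dots> = r * (2 * Re s + (norm s)\<^sup>2 / r) + r\<^sup>2"
        using r(1) by (simp add: field_simps)
      finally have "(norm (s + of_real r))\<^sup>2 = r * (2 * Re s + (norm s)\<^sup>2 / r) + r\<^sup>2" .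
      then show ?thesis using r(1) by simp
    qed
    also have "(norm (s + of_real r))\<^sup>2 = r\<^sup>2 \<longleftrightarrow> s \<in> sphere (- of_real r) r" for s
      using r by (simp add: dist_norm norm_minus_commute[of "- of_real r" s])
    finally show ?thesis by blast
  qed
  then have "connected S" by (simp add: connected_sphere)
  moreover have "continuous_on S (\<lambda>s. reflection s v ** U)"
    unfolding reflection_def mat_scale_def map_matrix_def
    by (intro continuous_on_matrix_mul continuous_intros)
  ultimately have "connected ((\<lambda>s. reflection s v ** U) ` S)"
    by (rule connected_continuous_image[rotated])
  moreover have "(\<lambda>s. reflection s v ** U) ` S \<subseteq> {U. unitary U}"
    using U by (auto simp: S_def intro: unitary_mul unitary_reflection)
  moreover have "reflection s v ** U \<in> (\<lambda>s. reflection s v ** U) ` S"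
    using s by (simp add: S_def)
  moreover have "U \<in> (\<lambda>s. reflection s v ** U) ` S"
    by (rule image_eqI[of _ _ 0]) (simp_all add: S_def)
  ultimately show ?thesis unfolding connected_component_def by blast
qed

text \<open>
  Induction on the number of basis vectors that \<open>U\<close> moves. If \<open>U\<close> moves \<open>e\<^sub>k\<close>, the Householder matrix
  in direction \<open>e\<^sub>k - U e\<^sub>k\<close> takes \<open>U e\<^sub>k\<close> back to \<open>e\<^sub>k\<close>. It does not disturb the basis vectors that
  are fixed already: such an \<open>e\<^sub>i\<close> is orthogonal to \<open>e\<^sub>k\<close>, and \<open>e\<^sub>i = U e\<^sub>i\<close> is orthogonal to \<open>U e\<^sub>k\<close>.
\<close>

lemma connected_component_unitary_mat_1:
  fixes U :: "complex^'n^'n"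
  assumes "unitary U"
  shows "connected_component {U. unitary U} U (mat 1)"
  using assms
proof (induction "card {i. U *v axis i 1 \<noteq> axis i 1}" arbitrary: U rule: less_induct)
  case less
  show ?case
  proof (cases "\<exists>k. U *v axis k 1 \<noteq> axis k 1")
    case False
    then have "U $ i $ j = mat 1 $ i $ j" for i j
      using matrix_vector_axis[of U j i] by (auto simp: axis_def mat_def)
    then have "U = mat 1" by (simp add: vec_eq_iff)
    then show ?thesis using less.prems by (simp add: connected_component_refl)
  next
    case True
    then obtain k where k: "U *v axis k 1 \<noteq> axis k 1" by blast
    define u where "u = axis k 1 - U *v axis k 1"
    have "cdot (axis k 1) (axis k 1) = cdot (U *v axis k 1) (U *v axis k 1)"
      using less.prems by (simp add: cdot_unitary)
    then obtain s where s: "s + cnj s + s * cnj s * cdot u u = 0"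
      and fix_k: "reflection s u *v (U *v axis k 1) = axis k 1"
      unfolding u_def by (rule householder)
    define V where "V = reflection s u ** U"
    have V: "unitary V"
      unfolding V_def by (intro unitary_mul unitary_reflection s less.prems)
    have "V *v axis i 1 = axis i 1" if i: "U *v axis i 1 = axis i 1" for i
    proof -
      have "i \<noteq> k" using i k by blast
      have "cdot u (axis i 1) = cdot (axis k 1) (axis i 1) - cdot (U *v axis k 1) (U *v axis i 1)"
        by (simp add: u_def cdot_diff_left i)
      (* U preserves the inner product, so the two terms cancel. *)
      also have "\<dots> = 0" using less.prems by (simp add: cdot_unitary)
      finally show ?thesis
        by (simp add: V_def i reflection_mul_vector flip: matrix_vector_mul_assoc)
    qed
    moreover have "V *v axis k 1 = axis k 1"
      using fix_k by (simp add: V_def matrix_vector_mul_assoc)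
    ultimately have "{i. V *v axis i 1 \<noteq> axis i 1} \<subset> {i. U *v axis i 1 \<noteq> axis i 1}"
      using k by blast
    then have "connected_component {U. unitary U} V (mat 1)"
      by (intro less.hyps psubset_card_mono V) auto
    moreover have "connected_component {U. unitary U} U V"
      unfolding V_def using reflection_connected[OF less.prems s] connected_component_sym by blast
    ultimately show ?thesis using connected_component_trans by blast
  qed
qed

lemma connected_unitary: "connected {U :: complex^'n^'n. unitary U}"
  unfolding connected_iff_connected_component
  by (metis connected_component_unitary_mat_1 connected_component_sym connected_component_trans
      mem_Collect_eq)

section \<open>Singletons and line segments\<close>

lemma joint_C_numerical_range_image:
  "joint_C_numerical_range C A = (\<lambda>U. \<chi> j. trace_form C (A $ j) U) ` {U. unitary U}"
  unfolding joint_C_numerical_range_def trace_form_def by blast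

lemma is_singleton_iff_scalar:
  fixes C :: "complex^'n^'n" and A :: "complex^'n^'n^'m"
  assumes "hermitian C" "\<not> (\<exists>c. C = mat c)"
  shows "is_singleton (joint_C_numerical_range C A) \<longleftrightarrow> (\<forall>j. \<exists>a. A $ j = mat a)"
proof
  assume "is_singleton (joint_C_numerical_range C A)"
  then obtain p where p: "joint_C_numerical_range C A = {p}" by (auto simp: is_singleton_def)
  have const: "trace_form C (A $ j) U = p $ j" if "unitary U" for U j
  proof -
    have "(\<chi> j. trace_form C (A $ j) U) \<in> {p}"
      using that unfolding p[symmetric] joint_C_numerical_range_image by blast
    then show ?thesis by auto
  qed
  show "\<forall>j. \<exists>a. A $ j = mat a"
    using scalar_if_trace_form_constant[OF assms const] by blast
next
  assume "\<forall>j. \<exists>a. A $ j = mat a"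
  then obtain a where a: "\<And>j. A $ j = mat (a j)" by metis
  have "joint_C_numerical_range C A = (\<lambda>U. \<chi> j. a j * trace C) ` {U :: complex^'n^'n. unitary U}"
    unfolding joint_C_numerical_range_image
    by (rule image_cong) (simp_all add: a trace_form_mat)
  also have "\<dots> = {\<chi> j. a j * trace C}" using unitary_mat_1 by auto
  finally show "is_singleton (joint_C_numerical_range C A)" by (simp add: is_singleton_def)
qed

lemma span_mat_1_insert:
  "X \<in> cmat.span {mat 1, H} \<longleftrightarrow> (\<exists>a b. X = mat a + mat_scale b H)"
proof -
  have "X \<in> cmat.span {mat 1, H} \<longleftrightarrow> (\<exists>a b. X - mat_scale a (mat 1) - mat_scale b H = 0)"
    by (simp add: cmat.span_breakdown_eq)
  then show ?thesis
    by (simp add: mat_scale_mat algebra_simps)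
qed

text \<open>
  For Hermitian \<open>H\<close> the number \<open>trace_form C H U\<close> is real, so as \<open>U\<close> varies it fills a compact
  interval; the numerical range is the image of this interval under \<open>t \<mapsto> p + t d\<close>.
\<close>

lemma is_line_segment_if_span:
  fixes C :: "complex^'n^'n" and A :: "complex^'n^'n^'m"
  assumes C: "hermitian C" and H: "hermitian H"
    and span: "\<And>j. A $ j \<in> cmat.span {mat 1, H}"
  shows "is_line_segment (joint_C_numerical_range C A)"
proof -
  obtain a b where A: "\<And>j. A $ j = mat (a j) + mat_scale (b j) H"
    using span unfolding span_mat_1_insert by metis
  define r where "r U = Re (trace_form C H U)" for U
  have real: "trace_form C H U = of_real (r U)" for U
    using trace_form_conj_transpose[OF C, of H U] H
    by (simp add: hermitian_def r_def complex_eq_iff)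
  have cont: "continuous_on {U. unitary U} r"
    unfolding r_def trace_form_def trace_def
    by (intro continuous_intros continuous_on_matrix_mul continuous_on_conj_transpose)
  have "connected (r ` {U. unitary U})" "compact (r ` {U. unitary U})"
    by (simp_all add: connected_continuous_image compact_continuous_image cont
        connected_unitary compact_unitary)
  then obtain x y where xy: "r ` {U. unitary U} = {x..y}"
    using connected_compact_interval_1 by (metis cbox_interval)
  have "r (mat 1) \<in> {x..y}"
    using unitary_mat_1 unfolding xy[symmetric] by blast
  then have "x \<le> y" by simp
  then have seg: "r ` {U. unitary U} = closed_segment x y"
    using xy by (simp add: closed_segment_eq_real_ivl)
  define p d where "p = (\<chi> j. a j * trace C)" and "d = (\<chi> j. b j)"
  have "(\<chi> j. trace_form C (A $ j) U) = p + r U *\<^sub>R d" if "unitary U" for U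
    using that
    by (simp add: A p_def d_def vec_eq_iff trace_form_add trace_form_scale trace_form_mat real)
      (simp add: scaleR_conv_of_real mult.commute)
  then have "joint_C_numerical_range C A = (\<lambda>U. p + r U *\<^sub>R d) ` {U. unitary U}"
    unfolding joint_C_numerical_range_image by (intro image_cong) simp_all
  also have "\<dots> = (\<lambda>z. p + z) ` (\<lambda>t. t *\<^sub>R d) ` r ` {U. unitary U}"
    by (simp add: image_image)
  also have "\<dots> = closed_segment (p + x *\<^sub>R d) (p + y *\<^sub>R d)"
    unfolding seg closed_segment_translation
    by (simp flip: closed_segment_linear_image[OF bounded_linear.linear[OF bounded_linear_scaleR_left]])
  finally show ?thesis
    unfolding is_line_segment_def segment_convex_hull by blast
qed

text \<open>
  On a segment all coordinates are governed by one real parameter \<open>t U\<close>. It cancels in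
  \<open>A\<^sub>j - d\<^sub>j G\<close>, and, being real, also in \<open>G - G\<^sup>*\<close>, where \<open>G = A\<^sub>k / d\<^sub>k\<close> is normalised so that its
  trace functional has speed \<open>1\<close> in \<open>t U\<close>. These two matrices are therefore scalar, which leaves
  only the Hermitian part of \<open>G\<close> to account for the variation of every \<open>A\<^sub>j\<close>.
\<close>

lemma span_if_is_line_segment:
  fixes C :: "complex^'n^'n" and A :: "complex^'n^'n^'m"
  assumes C: "hermitian C" and nonscalar: "\<not> (\<exists>c. C = mat c)"
    and seg: "is_line_segment (joint_C_numerical_range C A)"
  shows "\<exists>H. hermitian H \<and> (\<forall>j. A $ j \<in> cmat.span {mat 1, H})"
proof -
  note scalar = scalar_if_trace_form_constant[OF C nonscalar]
  obtain p q where pq: "joint_C_numerical_range C A = closed_segment p q"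
    using seg unfolding is_line_segment_def segment_convex_hull by blast
  define d where "d = q - p"
  have "\<exists>t. \<forall>j. trace_form C (A $ j) U = p $ j + of_real t * d $ j" if "unitary U" for U
  proof -
    have "(\<chi> j. trace_form C (A $ j) U) \<in> closed_segment p q"
      using that unfolding pq[symmetric] joint_C_numerical_range_image by blast
    then obtain t where "(\<chi> j. trace_form C (A $ j) U) = (1 - t) *\<^sub>R p + t *\<^sub>R q"
      by (auto simp: closed_segment_def)
    then have "trace_form C (A $ j) U = (1 - t) *\<^sub>R (p $ j) + t *\<^sub>R (q $ j)" for j
      by (simp add: vec_eq_iff)
    then show ?thesis
      by (intro exI[of _ t]) (simp add: d_def scaleR_conv_of_real algebra_simps)
  qed
  then obtain t where
    t: "\<And>U j. unitary U \<Longrightarrow> trace_form C (A $ j) U = p $ j + of_real (t U) * d $ j"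
    by metis
  show ?thesis
  proof (cases "d = 0")
    case True
    have "\<exists>a. A $ j = mat a" for j
      using scalar[of "A $ j" "p $ j"] t True by simp
    then have "A $ j \<in> cmat.span {mat 1, mat 1}" for j
      unfolding span_mat_1_insert by (metis add.right_neutral cmat.scale_zero_left)
    moreover have "hermitian (mat 1 :: complex^'n^'n)"
      by (simp add: hermitian_def)
    ultimately show ?thesis by blast
  next
    case False
    then obtain k where k: "d $ k \<noteq> 0" by (auto simp: vec_eq_iff)
    define G where "G = mat_scale (1 / d $ k) (A $ k)"
    have G: "trace_form C G U = p $ k / d $ k + of_real (t U)" if "unitary U" for U
      using k t[OF that, of k] by (simp add: G_def trace_form_scale field_simps)
    have "\<exists>s. A $ j - mat_scale (d $ j) G = mat s" for j
      by (rule scalar[of _ "p $ j - d $ j * (p $ k / d $ k)"])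
        (simp add: trace_form_diff trace_form_scale G t algebra_simps)
    then obtain s where s: "\<And>j. A $ j - mat_scale (d $ j) G = mat (s j)" by metis
    have "\<exists>c. G - conj_transpose G = mat c"
      by (rule scalar[of _ "p $ k / d $ k - cnj (p $ k / d $ k)"])
        (simp add: trace_form_diff trace_form_conj_transpose[OF C] G)
    then obtain c where c: "G - conj_transpose G = mat c" by blast
    define H where "H = mat_scale (1/2) (G + conj_transpose G)"
    have "hermitian H"
      by (simp add: H_def hermitian_def vec_eq_iff conj_transpose_nth mat_scale_nth)
    moreover have "A $ j = mat (s j + d $ j * c / 2) + mat_scale (d $ j) H" for j
    proof -
      have "G $ i $ l - conj_transpose G $ i $ l = mat c $ i $ l"
        "A $ j $ i $ l - d $ j * G $ i $ l = mat (s j) $ i $ l" for i l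
        by (simp_all flip: c s add: mat_scale_nth)
      then have "A $ j $ i $ l = mat (s j) $ i $ l + d $ j * mat c $ i $ l / 2 + d $ j * H $ i $ l"
        for i l
        by (simp add: H_def mat_scale_nth field_simps; algebra)
      then show ?thesis
        by (simp add: vec_eq_iff mat_scale_nth mat_def)
    qed
    ultimately show ?thesis unfolding span_mat_1_insert by blast
  qed
qed

theorem theorem3p5:
  fixes C :: "complex^'n^'n" and A :: "complex^'n^'n^'m"
  assumes "hermitian C"
    and "\<not> (\<exists>c. C = mat c)"
  shows "(is_singleton (joint_C_numerical_range C A) \<longleftrightarrow> (\<forall>j. \<exists>a. A $ j = mat a)) \<and>
    (is_line_segment (joint_C_numerical_range C A) \<longleftrightarrow>
      (\<exists>H. hermitian H \<and> (\<forall>j. A $ j \<in> cmat.span {mat 1, H})))"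
  using is_singleton_iff_scalar[OF assms] span_if_is_line_segment[OF assms]
    is_line_segment_if_span[OF assms(1)] by blast

end
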